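(* Let $T$ be a finite group. There exists a natural number $n_0(T)$, depending on $T$, such that for all $n\ge n_0(T)$ the group $T$ is a normalizer quotient of the symmetric group $S_n$ and also a normalizer quotient of the alternating group $A_n$.
   Context: A group $T$ is called a normalizer quotient of a group $S$ if there exists a subgroup $H\leq S$ such that $N_S(H)/H\cong T$, where $N_S(H)$ denotes the normalizer of $H$ in $S$. *)

theory Defs
  imports "HOL-Algebra.Algebra"
begin

text \<open>
  For a subgroup \<open>H\<close>, the library's \<^const>\<open>normalizer\<close> is the stabilizer of \<open>H\<close> under conjugation
  of subsets of the carrier, i.e. the set of all \<open>g\<close> with \<open>g H g\<inverse> = H\<close>.
\<close>

definition normalizer_quotient ::
    "('a, 'c) monoid_scheme \<Rightarrow> ('b, 'd) monoid_scheme \<Rightarrow> bool"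
  where "normalizer_quotient T S \<longleftrightarrow>
    (\<exists>H. subgroup H S \<and> (S\<lparr>carrier := normalizer S H\<rparr>) Mod H \<cong> T)"

end

theory Submission
  imports Defs
begin

text \<open>
  Let \<open>P = T \<times> {..<m}\<close>, split into the columns \<open>{e} \<times> {..<m}\<close>, and let \<open>Y\<close> be the group of all
  permutations of \<open>P\<close> that fix every column setwise. Let \<open>Y\<close> act on the set \<open>\<Omega>\<close> consisting of the
  points of \<open>P\<close> and of those subsets \<open>A\<close> of \<open>P\<close> whose column sizes are \<open>e \<mapsto> j (x e)\<close> for some
  \<open>x \<in> T\<close>, where \<open>j\<close> is a fixed injection with \<open>2 \<le> j e < m / 2\<close>. A permutation \<open>g\<close> of \<open>\<Omega>\<close> that
  normalizes \<open>Y\<close> preserves \<open>P\<close>, because the \<open>Y\<close>-orbits of the points have size \<open>m\<close> and the other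
  orbits are larger. Conjugating transpositions by \<open>g\<close> shows that \<open>g\<close> permutes the columns and
  that \<open>g A\<close> agrees, up to complements in columns, with the image of \<open>A\<close> under \<open>g\<close> restricted
  to \<open>P\<close>; since both meet every column in fewer than \<open>m / 2\<close> points, they are equal. As \<open>j\<close> is
  injective, the column permutation is a left translation of \<open>T\<close>, and all left translations
  occur, so the normalizer modulo \<open>Y\<close> is \<open>T\<close>. Finally, adjoin a set \<open>\<Delta>\<close> with more than \<open>|\<Omega>|\<close>
  points, on which the full symmetric group acts: this gives every large degree, and
  intersecting with the alternating group does not change the quotient, because parities can
  be corrected on \<open>\<Delta>\<close>.
\<close>

section \<open>Normalizer quotients from a homomorphism\<close>

text \<open>As the kernel of \<open>\<theta>\<close>, \<open>K\<close> is normal in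
  \<open>N\<close>, so \<open>N\<close> lies in its normalizer; \<open>sub\<close> is the converse,
  and the first isomorphism theorem does the rest.\<close>

lemma normalizer_quotientI:
  assumes G: "group G" and T: "group T" and N: "subgroup N G"
    and hom: "\<theta> \<in> hom (G\<lparr>carrier := N\<rparr>) T" and onto: "\<theta> ` N = carrier T"
    and K: "K = {g \<in> N. \<theta> g = \<one>\<^bsub>T\<^esub>}" and sub: "normalizer G K \<subseteq> N"
  shows "normalizer_quotient T G"
proof -
  interpret G: group G by (rule G)
  interpret GN: group "G\<lparr>carrier := N\<rparr>"
    by (rule G.subgroup_imp_group[OF N])
  interpret h: group_hom "G\<lparr>carrier := N\<rparr>" T \<theta>
    using hom T by (simp add: group_hom_def group_hom_axioms_def GN.group_axioms)
  have ker: "kernel (G\<lparr>carrier := N\<rparr>) T \<theta> = K"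
    by (auto simp: kernel_def K)
  have nrm: "normal K (G\<lparr>carrier := N\<rparr>)"
    using h.normal_kernel ker by simp
  have subK: "subgroup K G"
    using G.incl_subgroup[OF N] h.subgroup_kernel ker by simp
  have KG: "K \<subseteq> carrier G"
    using subK subgroup.subset by blast
  have "N \<subseteq> normalizer G K"
  proof
    fix g assume g: "g \<in> N"
    then have gG: "g \<in> carrier G"
      using N subgroup.subset by blast
    have "g <#\<^bsub>G\<^esub> K = K #>\<^bsub>G\<^esub> g"
      using normal.coset_eq[OF nrm] g by (simp add: l_coset_def r_coset_def)
    then have "g <#\<^bsub>G\<^esub> K #>\<^bsub>G\<^esub> inv\<^bsub>G\<^esub> g = K"
      using G.coset_mult_assoc[OF KG gG] gG KG by (simp add: G.coset_mult_one)
    then show "g \<in> normalizer G K"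
      using gG KG by (simp add: normalizer_def stabilizer_def)
  qed
  with sub have "normalizer G K = N" by blast
  then show ?thesis
    using h.FactGroup_iso onto subK ker by (auto simp: normalizer_quotient_def)
qed

lemma conj_mem_if_normalizer:
  assumes "g \<in> normalizer G K" "K \<subseteq> carrier G" "k \<in> K"
  shows "g \<otimes>\<^bsub>G\<^esub> k \<otimes>\<^bsub>G\<^esub> inv\<^bsub>G\<^esub> g \<in> K"
proof -
  have "g <#\<^bsub>G\<^esub> K #>\<^bsub>G\<^esub> inv\<^bsub>G\<^esub> g = K"
    using assms by (simp add: normalizer_def stabilizer_def)
  then show "g \<otimes>\<^bsub>G\<^esub> k \<otimes>\<^bsub>G\<^esub> inv\<^bsub>G\<^esub> g \<in> K"
    using assms(3) by (auto simp: l_coset_def r_coset_def)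
qed

section \<open>Columns, profiled sets and lifts of translations\<close>

locale column_code = group T for T :: "('a, 'b) monoid_scheme" (structure) +
  fixes j :: "'a \<Rightarrow> nat" and m :: nat
  assumes fin: "finite (carrier T)" and inj_j: "inj_on j (carrier T)"
    and j_bounds: "e \<in> carrier T \<Longrightarrow> 2 \<le> j e \<and> 2 * j e < m"
begin

definition pts :: "('a \<times> nat) set"
  where "pts = carrier T \<times> {..<m}"

definition col :: "'a \<Rightarrow> ('a \<times> nat) set"
  where "col e = {e} \<times> {..<m}"

definition profiled :: "('a \<times> nat) set set"
  where "profiled = {A. A \<subseteq> pts \<and>
    (\<exists>x\<in>carrier T. \<forall>e\<in>carrier T. card (col e \<inter> A) = j (x \<otimes> e))}"

text \<open>Points enter as singletons, so that permutations act on all members by taking images. No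
  profiled set is a singleton, its column sizes being at least 2.\<close>

definition fam :: "('a \<times> nat) set set"
  where "fam = (\<lambda>p. {p}) ` pts \<union> profiled"

text \<open>Lifts of a left translation to the points; \<open>shift \<one>\<close> is the group
  \<open>Y\<close>.\<close>

definition shift :: "'a \<Rightarrow> ('a \<times> nat \<Rightarrow> 'a \<times> nat) set"
  where "shift t = {s. s permutes pts \<and> (\<forall>p\<in>pts. fst (s p) = t \<otimes> fst p)}"

lemma finite_pts: "finite pts"
  using fin by (simp add: pts_def)

lemma finite_fam: "finite fam"
  using finite_pts by (auto simp: fam_def profiled_def)

lemma finite_col: "finite (col e)" and card_col: "card (col e) = m"
  by (auto simp: col_def card_cartesian_product)

lemma col_subset: "e \<in> carrier T \<Longrightarrow> col e \<subseteq> pts"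
  by (auto simp: col_def pts_def)

lemma mem_col_iff: "p \<in> col e \<longleftrightarrow> fst p = e \<and> snd p < m"
  by (cases p) (auto simp: col_def)

lemma mem_pts_iff: "p \<in> pts \<longleftrightarrow> fst p \<in> carrier T \<and> snd p < m"
  by (cases p) (auto simp: pts_def)

lemma five_le_m: "5 \<le> m"
  using j_bounds[of \<one>] by simp

lemma fam_subset_pts: "A \<in> fam \<Longrightarrow> A \<subseteq> pts"
  by (auto simp: fam_def profiled_def)

lemma shift_one_id: "id \<in> shift \<one>"
  by (auto simp: shift_def permutes_id mem_pts_iff)

lemma shift_mult:
  assumes "s \<in> shift t" "s' \<in> shift t'" "t \<in> carrier T" "t' \<in> carrier T"
  shows "s \<circ> s' \<in> shift (t \<otimes> t')"
proof -
  have "s' p \<in> pts" if "p \<in> pts" for p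
    using assms(2) that by (simp add: shift_def permutes_in_image)
  then show ?thesis
    using assms by (auto simp: shift_def permutes_compose m_assoc mem_pts_iff)
qed

lemma shift_inv:
  assumes "s \<in> shift t" "t \<in> carrier T"
  shows "inv' s \<in> shift (inv t)"
proof -
  have s: "s permutes pts" using assms by (simp add: shift_def)
  have "fst (inv' s p) = inv t \<otimes> fst p" if p: "p \<in> pts" for p
  proof -
    have q: "inv' s p \<in> pts" using permutes_inv[OF s] p by (simp add: permutes_in_image)
    have "fst p = t \<otimes> fst (inv' s p)"
      using assms(1) q permutes_inverses(1)[OF s, of p] by (auto simp: shift_def)
    moreover have "fst (inv' s p) \<in> carrier T" using q by (simp add: mem_pts_iff)
    ultimately show ?thesis
      using assms(2) by (simp add: inv_solve_left)
  qed
  then show ?thesis using permutes_inv[OF s] by (simp add: shift_def)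
qed

lemma shift_unique:
  assumes "s \<in> shift t" "s \<in> shift t'" "t \<in> carrier T" "t' \<in> carrier T"
  shows "t = t'"
proof -
  have "(\<one>, 0) \<in> pts" using five_le_m by (auto simp: pts_def)
  then have "fst (s (\<one>, 0)) = t \<otimes> \<one>" "fst (s (\<one>, 0)) = t' \<otimes> \<one>"
    using assms(1,2) by (force simp: shift_def)+
  then show ?thesis using assms(3,4) by simp
qed

lemma ex_shift:
  assumes t: "t \<in> carrier T"
  shows "\<exists>s. s \<in> shift t"
proof -
  define s where "s p = (if p \<in> pts then (t \<otimes> fst p, snd p) else p)" for p
  have "inj_on s pts"
    using t by (auto simp: inj_on_def s_def mem_pts_iff prod_eq_iff)
  moreover have "s ` pts \<subseteq> pts"
    using t by (auto simp: s_def mem_pts_iff)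
  ultimately have "bij_betw s pts pts"
    using finite_pts by (simp add: bij_betw_def endo_inj_surj)
  then have "s permutes pts"
    by (rule bij_imp_permutes) (simp add: s_def)
  then show ?thesis by (auto simp: shift_def s_def)
qed

lemma transpose_shift_one:
  assumes "p \<in> pts" "q \<in> pts" "fst p = fst q"
  shows "transpose p q \<in> shift \<one>"
  using assms permutes_swap_id[OF assms(1,2)]
  by (auto simp: shift_def transpose_def mem_pts_iff)

lemma shift_image_col:
  assumes "s \<in> shift t" "t \<in> carrier T" "e \<in> carrier T"
  shows "s ` col e = col (t \<otimes> e)"
proof (rule card_subset_eq)
  have s: "s permutes pts" and f: "\<And>p. p \<in> pts \<Longrightarrow> fst (s p) = t \<otimes> fst p"
    using assms(1) by (auto simp: shift_def)
  show "finite (col (t \<otimes> e))" by (rule finite_col)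
  show "s ` col e \<subseteq> col (t \<otimes> e)"
  proof
    fix q assume "q \<in> s ` col e"
    then obtain p where p: "p \<in> col e" "q = s p" by blast
    then have "p \<in> pts" using col_subset assms(3) by blast
    then have "s p \<in> pts" "fst (s p) = t \<otimes> e"
      using s f p by (auto simp: permutes_in_image mem_col_iff)
    then show "q \<in> col (t \<otimes> e)" using p by (simp add: mem_col_iff mem_pts_iff)
  qed
  show "card (s ` col e) = card (col (t \<otimes> e))"
    using permutes_inj_on[OF s] by (simp add: card_image card_col)
qed

lemma shift_fam:
  assumes s: "s \<in> shift t" and t: "t \<in> carrier T" and A: "A \<in> fam"
  shows "s ` A \<in> fam"
proof -
  have sp: "s permutes pts" using s by (simp add: shift_def)
  have sub: "s ` A \<subseteq> pts"
    using fam_subset_pts[OF A] sp permutes_image by blast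
  consider p where "p \<in> pts" "A = {p}"
    | x where "x \<in> carrier T" "\<And>e. e \<in> carrier T \<Longrightarrow> card (col e \<inter> A) = j (x \<otimes> e)"
    using A by (auto simp: fam_def profiled_def)
  then show ?thesis
  proof cases
    case 1
    then show ?thesis using sub by (auto simp: fam_def)
  next
    case 2
    \<comment> \<open>Column \<open>f\<close> of the image comes from column
      \<open>inv t \<otimes> f\<close> of \<open>A\<close>, so the parameter \<open>x\<close>
      becomes \<open>x \<otimes> inv t\<close>.\<close>
    have "card (col f \<inter> s ` A) = j (x \<otimes> inv t \<otimes> f)" if f: "f \<in> carrier T" for f
    proof -
      have "s ` col (inv t \<otimes> f) = col f"
        using shift_image_col[OF s t, of "inv t \<otimes> f"] t f
        by (simp add: m_assoc[symmetric])
      then have "col f \<inter> s ` A = s ` (col (inv t \<otimes> f) \<inter> A)"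
        using permutes_inj[OF sp] by (simp add: image_Int)
      then have "card (col f \<inter> s ` A) = card (col (inv t \<otimes> f) \<inter> A)"
        using permutes_inj_on[OF sp] by (simp add: card_image)
      then show ?thesis using 2 t f by (simp add: m_assoc)
    qed
    moreover have "x \<otimes> inv t \<in> carrier T" using 2 t by simp
    ultimately show ?thesis using sub by (auto simp: fam_def profiled_def)
  qed
qed

text \<open>This excludes complements later: two sets, each below half of a column, cannot cover
  it.\<close>

lemma card_col_Int_less:
  assumes "A \<in> fam" "e \<in> carrier T"
  shows "2 * card (col e \<inter> A) < m"
proof -
  consider p where "A = {p}" | x where "x \<in> carrier T" "card (col e \<inter> A) = j (x \<otimes> e)"
    using assms by (auto simp: fam_def profiled_def)
  then show ?thesis
  proof cases
    case 1
    have "card (col e \<inter> A) \<le> 1"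
      using card_mono[of "{p}" "col e \<inter> A"] 1 by simp
    then show ?thesis using five_le_m by simp
  next
    case 2
    then show ?thesis using j_bounds assms(2) by simp
  qed
qed

lemma ex_profile: "\<exists>A \<in> profiled. \<forall>e\<in>carrier T. card (col e \<inter> A) = j e"
proof
  let ?A = "SIGMA e:carrier T. {..<j e}"
  have c: "card (col e \<inter> ?A) = j e" if e: "e \<in> carrier T" for e
  proof -
    have "col e \<inter> ?A = {e} \<times> {..<j e}"
      using j_bounds[OF e] e by (auto simp: col_def)
    then show ?thesis by (simp add: card_cartesian_product)
  qed
  show "\<forall>e\<in>carrier T. card (col e \<inter> ?A) = j e" using c by blast
  have "?A \<subseteq> pts" using j_bounds by (force simp: pts_def)
  then show "?A \<in> profiled" using c by (auto simp: profiled_def intro!: bexI[of _ \<one>])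
qed

text \<open>If \<open>A\<close> has \<open>k\<close> points in a column, exchanging one of them for
  one of the \<open>m - k\<close> others gives \<open>k * (m - k)\<close> different sets, which
  exceeds \<open>m\<close> because \<open>k \<ge> 2\<close> and
  \<open>m - k > m / 2\<close>.\<close>

lemma card_transposes_greater:
  assumes A: "A \<in> profiled"
  obtains e where "e \<in> carrier T"
    "m < card ((\<lambda>(p, q). transpose p q ` A) ` ((col e \<inter> A) \<times> (col e - A)))"
proof -
  obtain x where x: "x \<in> carrier T" "card (col \<one> \<inter> A) = j (x \<otimes> \<one>)"
    using A by (auto simp: profiled_def)
  let ?k = "card (col \<one> \<inter> A)" and ?B = "(col \<one> \<inter> A) \<times> (col \<one> - A)"
  have k: "2 \<le> ?k" "2 * ?k < m" using j_bounds[of "x \<otimes> \<one>"] x by simp_all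
  have "card (col \<one> - A) = m - ?k"
    using card_Diff_subset_Int[of "col \<one>" A] finite_col[of \<one>] by (simp add: card_col)
  then have cB: "card ?B = ?k * (m - ?k)"
    by (simp add: card_cartesian_product)
  have img: "transpose p q ` A = insert q (A - {p})" if "p \<in> A" "q \<notin> A" for p q
    using that by (auto simp: transpose_def image_iff)
  \<comment> \<open>Both \<open>p\<close> and \<open>q\<close> can be read off from the new set,
    whence injectivity.\<close>
  have diff: "A - transpose p q ` A = {p}" "transpose p q ` A - A = {q}"
    if "p \<in> A" "q \<notin> A" for p q
    using that by (auto simp: img)
  have "inj_on (\<lambda>(p, q). transpose p q ` A) ?B"
    by (rule inj_onI) (force dest: diff)
  then have "card ((\<lambda>(p, q). transpose p q ` A) ` ?B) = ?k * (m - ?k)"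
    using cB by (simp add: card_image)
  moreover have "m < 2 * (m - ?k)" using k by simp
  then have "m < ?k * (m - ?k)"
    using mult_le_mono1[OF k(1), of "m - ?k"] by linarith
  ultimately show ?thesis using that[of \<one>] by simp
qed

end

section \<open>The action on \<open>\<Omega>\<close>, padded by \<open>\<Delta>\<close>\<close>

lemma transpose_image_eq_iff: "transpose p q ` A = A \<longleftrightarrow> (p \<in> A \<longleftrightarrow> q \<in> A)"
  by (auto simp: transpose_def image_iff split: if_splits)

text \<open>
  The labelling \<open>L\<close> allows \<open>\<Omega>\<close> to be an initial segment of \<open>{1..n}\<close>. The assumption \<open>parity\<close>
  is what the symmetric and the alternating group have in common.
\<close>

locale column_action = column_code T j m + G: group G
  for T :: "('a, 'b) monoid_scheme" (structure) and j m
    and G :: "('p \<Rightarrow> 'p, 'c) monoid_scheme" +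
  fixes \<Omega> \<Delta> :: "'p set" and L :: "'p \<Rightarrow> ('a \<times> nat) set"
  assumes bij_L: "bij_betw L \<Omega> fam"
    and disjoint: "\<Omega> \<inter> \<Delta> = {}" and fin_\<Delta>: "finite \<Delta>"
    and card_\<Delta>: "card \<Omega> < card \<Delta>" "3 \<le> card \<Delta>"
    and carrier_permutes: "g \<in> carrier G \<Longrightarrow> g permutes (\<Omega> \<union> \<Delta>)"
    and mult_G: "\<And>x y. x \<otimes>\<^bsub>G\<^esub> y = x \<circ> y" and one_G: "\<one>\<^bsub>G\<^esub> = id"
    and parity: "\<lbrakk>g permutes (\<Omega> \<union> \<Delta>); c \<in> \<Delta>; d \<in> \<Delta>; c \<noteq> d\<rbrakk> \<Longrightarrow>
      g \<in> carrier G \<or> g \<circ> transpose c d \<in> carrier G"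
begin

text \<open>Only the behaviour on \<open>\<Omega>\<close> is prescribed, which leaves room on
  \<open>\<Delta>\<close> for parity corrections.\<close>

definition acts :: "('a \<times> nat \<Rightarrow> 'a \<times> nat) \<Rightarrow> ('p \<Rightarrow> 'p) \<Rightarrow> bool"
  where "acts s g \<longleftrightarrow> (\<forall>u\<in>\<Omega>. g u \<in> \<Omega> \<and> L (g u) = s ` L u)"

definition N :: "('p \<Rightarrow> 'p) set"
  where "N = {g \<in> carrier G. \<exists>t\<in>carrier T. \<exists>s\<in>shift t. acts s g}"

text \<open>The subgroup whose normalizer is computed: it acts as \<open>Y\<close> on
  \<open>\<Omega>\<close> and is restricted on \<open>\<Delta>\<close> only by membership in
  \<open>G\<close>.\<close>

definition K :: "('p \<Rightarrow> 'p) set"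
  where "K = {g \<in> carrier G. \<exists>s\<in>shift \<one>. acts s g}"

definition \<theta> :: "('p \<Rightarrow> 'p) \<Rightarrow> 'a"
  where "\<theta> g = (THE t. t \<in> carrier T \<and> (\<exists>s\<in>shift t. acts s g))"

definition pt :: "'a \<times> nat \<Rightarrow> 'p"
  where "pt p = inv_into \<Omega> L {p}"

definition orb :: "'p \<Rightarrow> 'p set"
  where "orb u = (\<lambda>k. k u) ` K"

lemma fin_\<Omega>: "finite \<Omega>"
  using bij_L finite_fam bij_betw_finite by blast

lemma L_in_fam: "u \<in> \<Omega> \<Longrightarrow> L u \<in> fam"
  using bij_betwE[OF bij_L] by blast

lemma L_eq_iff: "u \<in> \<Omega> \<Longrightarrow> v \<in> \<Omega> \<Longrightarrow> L u = L v \<longleftrightarrow> u = v"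
  using inj_on_eq_iff[OF bij_betw_imp_inj_on[OF bij_L]] .

lemma L_inv_into: "A \<in> fam \<Longrightarrow> inv_into \<Omega> L A \<in> \<Omega> \<and> L (inv_into \<Omega> L A) = A"
  using bij_betw_imp_surj_on[OF bij_L] inv_into_into[of A L \<Omega>] f_inv_into_f[of A L \<Omega>]
  by simp

lemma pt_in: "p \<in> pts \<Longrightarrow> pt p \<in> \<Omega>" and L_pt: "p \<in> pts \<Longrightarrow> L (pt p) = {p}"
  using L_inv_into[of "{p}"] by (simp_all add: pt_def fam_def)

lemma inv_apply:
  assumes "g \<in> carrier G"
  shows "(inv\<^bsub>G\<^esub> g) (g u) = u" "g ((inv\<^bsub>G\<^esub> g) u) = u"
  using fun_cong[OF G.l_inv[OF assms], of u] fun_cong[OF G.r_inv[OF assms], of u]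
  by (simp_all add: mult_G one_G)

text \<open>Provides a transposition for parity corrections that fixes \<open>a\<close>.\<close>

lemma ex_two_padding:
  obtains c d where "c \<in> \<Delta>" "d \<in> \<Delta>" "c \<noteq> d" "c \<noteq> a" "d \<noteq> a"
proof -
  have "2 \<le> card (\<Delta> - {a})"
    using card_\<Delta>(2) diff_card_le_card_Diff[of "{a}" \<Delta>] by simp
  then obtain B where B: "B \<subseteq> \<Delta> - {a}" "card B = 2"
    by (rule obtain_subset_with_card_n)
  then obtain c d where "B = {c, d}" "c \<noteq> d" by (meson card_2_iff)
  then show ?thesis using that[of c d] B(1) by blast
qed

lemma acts_comp: "acts s g \<Longrightarrow> acts s' g' \<Longrightarrow> acts (s \<circ> s') (g \<circ> g')"
  by (simp add: acts_def image_comp)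

lemma acts_inv:
  assumes "acts s g" "g \<in> carrier G" "s permutes pts"
  shows "acts (inv' s) (inv\<^bsub>G\<^esub> g)"
  unfolding acts_def
proof (intro ballI)
  fix u assume u: "u \<in> \<Omega>"
  have "inj_on g \<Omega>"
    using permutes_inj_on[OF carrier_permutes[OF assms(2)]] .
  then have "g ` \<Omega> = \<Omega>"
    using assms(1) fin_\<Omega> by (intro endo_inj_surj) (auto simp: acts_def)
  then obtain w where w: "w \<in> \<Omega>" "u = g w" using u by blast
  then have "L u = s ` L w" using assms(1) by (simp add: acts_def)
  then have "inv' s ` L u = L w"
    using permutes_inv_o(2)[OF assms(3)] by (simp add: image_comp)
  then show "(inv\<^bsub>G\<^esub> g) u \<in> \<Omega> \<and> L ((inv\<^bsub>G\<^esub> g) u) = inv' s ` L u"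
    using w assms(2) by (simp add: inv_apply)
qed

lemma acts_pt:
  assumes "acts s g" "p \<in> pts" shows "L (g (pt p)) = {s p}"
  using assms by (simp add: acts_def pt_in L_pt)

text \<open>The action on singletons determines \<open>s\<close>, and \<open>s\<close> determines
  \<open>t\<close>; so the definite description is well defined.\<close>

lemma \<theta>_eq:
  assumes "t \<in> carrier T" "s \<in> shift t" "acts s g"
  shows "\<theta> g = t"
  unfolding \<theta>_def
proof (rule the_equality)
  show "t \<in> carrier T \<and> (\<exists>s\<in>shift t. acts s g)" using assms by blast
  fix t' assume "t' \<in> carrier T \<and> (\<exists>s\<in>shift t'. acts s g)"
  then obtain s' where s': "t' \<in> carrier T" "s' \<in> shift t'" "acts s' g" by blast
  have "s p = s' p" if "p \<in> pts" for p
    using acts_pt[OF assms(3) that] acts_pt[OF s'(3) that] by simp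
  moreover have "s permutes pts" "s' permutes pts"
    using assms(2) s'(2) by (simp_all add: shift_def)
  then have "s p = s' p" if "p \<notin> pts" for p
    using that by (simp add: permutes_not_in)
  ultimately have "s = s'" by blast
  then show "t' = t" using shift_unique assms s' by blast
qed

text \<open>Transport \<open>s\<close> through \<open>L\<close> and extend by the identity. If the
  result is not in \<open>G\<close>, a transposition on \<open>\<Delta>\<close> repairs it without
  changing the action on \<open>\<Omega>\<close>.\<close>

lemma ex_acts:
  assumes "s \<in> shift t" "t \<in> carrier T"
  shows "\<exists>g\<in>carrier G. acts s g"
proof -
  define h where "h u = (if u \<in> \<Omega> then inv_into \<Omega> L (s ` L u) else u)" for u
  have h: "h u \<in> \<Omega> \<and> L (h u) = s ` L u" if "u \<in> \<Omega>" for u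
    using that L_inv_into[OF shift_fam[OF assms L_in_fam[OF that]]] by (simp add: h_def)
  have "inj s" using assms by (auto simp: shift_def permutes_inj)
  then have "inj_on h \<Omega>"
    using h by (intro inj_onI) (metis L_eq_iff inj_image_eq_iff)
  then have "h ` \<Omega> = \<Omega>"
    using h fin_\<Omega> by (intro endo_inj_surj) auto
  then have "h permutes \<Omega>"
    using \<open>inj_on h \<Omega>\<close> by (intro bij_imp_permutes) (auto simp: bij_betw_def h_def)
  then have hp: "h permutes (\<Omega> \<union> \<Delta>)"
    by (rule permutes_subset) simp
  obtain c d where cd: "c \<in> \<Delta>" "d \<in> \<Delta>" "c \<noteq> d" by (rule ex_two_padding)
  have "acts s h" using h by (simp add: acts_def)
  moreover have "transpose c d u = u" if "u \<in> \<Omega>" for u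
    using that cd disjoint by (auto simp: transpose_def)
  then have "acts s (h \<circ> transpose c d)" using h by (simp add: acts_def)
  ultimately show ?thesis using parity[OF hp cd] by blast
qed

section \<open>The homomorphism from \<open>N\<close> onto \<open>T\<close> with kernel
  \<open>K\<close>\<close>

lemma K_subset: "K \<subseteq> carrier G"
  by (auto simp: K_def)

lemma subgroup_N: "subgroup N G"
proof (rule G.subgroupI)
  show "N \<subseteq> carrier G" by (auto simp: N_def)
  have "acts id id" by (simp add: acts_def)
  then have "\<one>\<^bsub>G\<^esub> \<in> N"
    using shift_one_id by (auto simp: N_def one_G[symmetric])
  then show "N \<noteq> {}" by blast
next
  fix g assume "g \<in> N"
  then obtain t s where *: "g \<in> carrier G" "t \<in> carrier T" "s \<in> shift t" "acts s g"
    by (auto simp: N_def)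
  then have "s permutes pts" by (simp add: shift_def)
  then have "acts (inv' s) (inv\<^bsub>G\<^esub> g)" using acts_inv * by blast
  moreover have "inv' s \<in> shift (inv t)" using shift_inv * by blast
  ultimately show "inv\<^bsub>G\<^esub> g \<in> N"
    using * by (auto simp: N_def intro!: bexI[of _ "inv t"])
next
  fix g g' assume "g \<in> N" "g' \<in> N"
  then obtain t s t' s' where *: "g \<in> carrier G" "t \<in> carrier T" "s \<in> shift t" "acts s g"
     "g' \<in> carrier G" "t' \<in> carrier T" "s' \<in> shift t'" "acts s' g'"
    by (auto simp: N_def)
  then have "s \<circ> s' \<in> shift (t \<otimes> t')" "acts (s \<circ> s') (g \<circ> g')"
    using shift_mult acts_comp by blast+
  moreover have "g \<circ> g' \<in> carrier G"
    using G.m_closed[of g g'] * by (simp add: mult_G)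
  ultimately show "g \<otimes>\<^bsub>G\<^esub> g' \<in> N"
    using * by (auto simp: N_def mult_G intro!: bexI[of _ "t \<otimes> t'"])
qed

lemma \<theta>_hom: "\<theta> \<in> hom (G\<lparr>carrier := N\<rparr>) T"
proof (rule homI)
  fix g assume "g \<in> carrier (G\<lparr>carrier := N\<rparr>)"
  then show "\<theta> g \<in> carrier T" using \<theta>_eq by (auto simp: N_def)
next
  fix g g' assume "g \<in> carrier (G\<lparr>carrier := N\<rparr>)" "g' \<in> carrier (G\<lparr>carrier := N\<rparr>)"
  then obtain t s t' s' where *: "t \<in> carrier T" "s \<in> shift t" "acts s g"
     "t' \<in> carrier T" "s' \<in> shift t'" "acts s' g'"
    by (auto simp: N_def)
  then have "s \<circ> s' \<in> shift (t \<otimes> t')" "acts (s \<circ> s') (g \<circ> g')"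
    using shift_mult acts_comp by blast+
  then have "\<theta> (g \<circ> g') = t \<otimes> t'" using * by (intro \<theta>_eq) auto
  then show "\<theta> (g \<otimes>\<^bsub>G\<lparr>carrier := N\<rparr>\<^esub> g') = \<theta> g \<otimes> \<theta> g'"
    using * \<theta>_eq by (simp add: mult_G)
qed

lemma \<theta>_onto: "\<theta> ` N = carrier T"
proof
  show "\<theta> ` N \<subseteq> carrier T" using \<theta>_eq by (auto simp: N_def)
  show "carrier T \<subseteq> \<theta> ` N"
  proof
    fix t assume t: "t \<in> carrier T"
    then obtain s g where "s \<in> shift t" "g \<in> carrier G" "acts s g"
      using ex_shift ex_acts by blast
    then have "g \<in> N" "\<theta> g = t" using t \<theta>_eq by (auto simp: N_def)
    then show "t \<in> \<theta> ` N" by blast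
  qed
qed

lemma K_eq: "K = {g \<in> N. \<theta> g = \<one>}"
  using \<theta>_eq by (auto simp: K_def N_def)

section \<open>Orbits of \<open>K\<close>\<close>

lemma orb_\<Omega>: "u \<in> \<Omega> \<Longrightarrow> orb u \<subseteq> \<Omega>"
  by (auto simp: orb_def K_def acts_def)

lemma finite_orb: "u \<in> \<Omega> \<union> \<Delta> \<Longrightarrow> finite (orb u)"
proof (rule finite_subset)
  assume "u \<in> \<Omega> \<union> \<Delta>"
  then have "k u \<in> \<Omega> \<union> \<Delta>" if "k \<in> K" for k
    using permutes_in_image[OF carrier_permutes] K_subset that by blast
  then show "orb u \<subseteq> \<Omega> \<union> \<Delta>" by (auto simp: orb_def)
  show "finite (\<Omega> \<union> \<Delta>)" using fin_\<Omega> fin_\<Delta> by simp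
qed

text \<open>The transposition of \<open>a\<close> and \<open>b\<close>, composed if necessary with a
  spare one that fixes \<open>a\<close>, fixes \<open>\<Omega>\<close> pointwise, lies in
  \<open>K\<close> and sends \<open>a\<close> to \<open>b\<close>.\<close>

lemma orb_\<Delta>:
  assumes a: "a \<in> \<Delta>"
  shows "\<Delta> \<subseteq> orb a"
proof
  fix b assume b: "b \<in> \<Delta>"
  have K: "k \<in> K" if "k \<in> carrier G" "\<And>u. u \<in> \<Omega> \<Longrightarrow> k u = u" for k
    using that shift_one_id by (auto simp: K_def acts_def intro!: bexI[of _ id])
  obtain c d where cd: "c \<in> \<Delta>" "d \<in> \<Delta>" "c \<noteq> d" "c \<noteq> a" "d \<noteq> a" by (rule ex_two_padding)
  have "transpose a b permutes (\<Omega> \<union> \<Delta>)"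
    using a b by (intro permutes_swap_id) auto
  moreover have "transpose a b u = u" "(transpose a b \<circ> transpose c d) u = u" if "u \<in> \<Omega>" for u
    using that a b cd disjoint by (auto simp: transpose_def)
  ultimately have "transpose a b \<in> K \<or> transpose a b \<circ> transpose c d \<in> K"
    using parity[OF _ cd(1-3)] K by blast
  moreover have "transpose a b a = b" "(transpose a b \<circ> transpose c d) a = b"
    using cd by (auto simp: transpose_def)
  ultimately show "b \<in> orb a"
    unfolding orb_def by (metis imageI)
qed

lemma card_orb_pt:
  assumes p: "p \<in> pts"
  shows "card (orb (pt p)) \<le> m"
proof -
  have "orb (pt p) \<subseteq> pt ` col (fst p)"
  proof
    fix v assume "v \<in> orb (pt p)"
    then obtain k s where k: "v = k (pt p)" "s \<in> shift \<one>" "acts s k"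
      by (auto simp: orb_def K_def)
    have sp: "s p \<in> pts"
      using k(2) p by (simp add: shift_def permutes_in_image)
    have fst_sp: "fst (s p) = fst p"
      using k(2) p by (simp add: shift_def mem_pts_iff)
    have "v \<in> \<Omega>" "L v = {s p}"
      using k p acts_pt by (auto simp: acts_def pt_in)
    then have "v = pt (s p)"
      using L_eq_iff pt_in L_pt sp by metis
    then show "v \<in> pt ` col (fst p)"
      using sp fst_sp by (auto simp: mem_col_iff mem_pts_iff)
  qed
  then have "card (orb (pt p)) \<le> card (pt ` col (fst p))"
    by (intro card_mono) (auto simp: finite_col)
  also have "\<dots> \<le> m"
    using card_image_le[OF finite_col] by (metis card_col)
  finally show ?thesis .
qed

text \<open>Transpositions within a column lift to \<open>K\<close>, so the orbit contains all sets
  counted in \<open>card_transposes_greater\<close>.\<close>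

lemma card_orb_profiled:
  assumes u: "u \<in> \<Omega>" and A: "L u \<in> profiled"
  shows "m < card (orb u)"
proof -
  obtain e where e: "e \<in> carrier T"
    "m < card ((\<lambda>(p, q). transpose p q ` L u) ` ((col e \<inter> L u) \<times> (col e - L u)))" (is "_ < card ?C")
    using card_transposes_greater[OF A] by blast
  have "?C \<subseteq> L ` orb u"
  proof clarify
    fix p q assume "p \<in> col e" "q \<in> col e"
    then have s: "transpose p q \<in> shift \<one>"
      using col_subset[OF e(1)] by (intro transpose_shift_one) (auto simp: mem_col_iff)
    then obtain k where k: "k \<in> carrier G" "acts (transpose p q) k"
      using ex_acts by blast
    then have "k u \<in> orb u" using s by (auto simp: orb_def K_def)
    moreover have "L (k u) = transpose p q ` L u" using k u by (simp add: acts_def)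
    ultimately show "transpose p q ` L u \<in> L ` orb u" by blast
  qed
  then have "card ?C \<le> card (orb u)"
    using finite_orb u by (intro surj_card_le) auto
  then show ?thesis using e by simp
qed

lemma card_orb_le_normalizer:
  assumes g: "g \<in> normalizer G K" and u: "u \<in> \<Omega> \<union> \<Delta>"
  shows "card (orb u) \<le> card (orb (g u))"
proof -
  have gG: "g \<in> carrier G"
    using g by (simp add: normalizer_def stabilizer_def)
  have "g ` orb u \<subseteq> orb (g u)"
  proof clarsimp
    fix v assume "v \<in> orb u"
    then obtain k where k: "k \<in> K" "v = k u" by (auto simp: orb_def)
    then have "g \<otimes>\<^bsub>G\<^esub> k \<otimes>\<^bsub>G\<^esub> inv\<^bsub>G\<^esub> g \<in> K"
      using conj_mem_if_normalizer[OF g K_subset] by blast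
    moreover have "(g \<otimes>\<^bsub>G\<^esub> k \<otimes>\<^bsub>G\<^esub> inv\<^bsub>G\<^esub> g) (g u) = g v"
      using gG k by (simp add: mult_G inv_apply)
    ultimately show "g v \<in> orb (g u)" unfolding orb_def by (metis imageI)
  qed
  moreover have "inj_on g (orb u)"
    using permutes_inj_on[OF carrier_permutes[OF gG]] .
  moreover have "g u \<in> \<Omega> \<union> \<Delta>"
    using permutes_in_image[OF carrier_permutes[OF gG]] u by blast
  ultimately show ?thesis
    using card_inj_on_le finite_orb by blast
qed

section \<open>The normalizer of \<open>K\<close> lies in \<open>N\<close>\<close>

lemma normalizer_subset: "normalizer G K \<subseteq> N"
proof
  fix g assume g: "g \<in> normalizer G K"
  then have gG: "g \<in> carrier G"
    by (simp add: normalizer_def stabilizer_def)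
  have inv_g: "inv\<^bsub>G\<^esub> g \<in> normalizer G K"
    using subgroup.m_inv_closed[OF G.normalizer_imp_subgroup[OF K_subset] g] .
  have inj_g: "inj g"
    using permutes_inj[OF carrier_permutes[OF gG]] .
  have gU: "g u \<in> \<Omega> \<union> \<Delta>" if "u \<in> \<Omega>" for u
    using permutes_in_image[OF carrier_permutes[OF gG]] that by blast
  have card_orb: "card (orb (g u)) \<le> card (orb u)" if "u \<in> \<Omega>" for u
    using card_orb_le_normalizer[OF inv_g gU[OF that]] gG by (simp add: inv_apply)
  \<comment> \<open>An element of \<open>\<Omega>\<close> sent into \<open>\<Delta>\<close> would
    need an orbit at least as large as \<open>\<Delta>\<close>, but its orbit lies in
    \<open>\<Omega>\<close>.\<close>
  have g\<Omega>: "g u \<in> \<Omega>" if u: "u \<in> \<Omega>" for u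
  proof (rule ccontr)
    assume "g u \<notin> \<Omega>"
    then have "g u \<in> \<Delta>" using gU u by blast
    then have "card \<Delta> \<le> card (orb (g u))"
      using orb_\<Delta> finite_orb by (intro card_mono) auto
    also have "\<dots> \<le> card (orb u)" using card_orb u .
    also have "\<dots> \<le> card \<Omega>" using orb_\<Omega>[OF u] fin_\<Omega> by (rule card_mono[rotated])
    finally show False using card_\<Delta> by simp
  qed
  \<comment> \<open>The restriction of \<open>g\<close> to the points, read from singleton labels;
    the default \<open>p\<close> makes \<open>s\<close> a permutation of \<open>pts\<close>.\<close>
  define s where "s p = (if p \<in> pts then the_elem (L (g (pt p))) else p)" for p
  have s: "L (g (pt p)) = {s p} \<and> s p \<in> pts" if p: "p \<in> pts" for p
  proof -
    \<comment> \<open>Orbit size separates points from profiled sets: at most \<open>m\<close>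
      against more than \<open>m\<close>.\<close>
    have "card (orb (g (pt p))) \<le> m"
      using card_orb[OF pt_in[OF p]] card_orb_pt[OF p] by simp
    then have "L (g (pt p)) \<notin> profiled"
      using card_orb_profiled[OF g\<Omega>[OF pt_in[OF p]]] by linarith
    then obtain q where "q \<in> pts" "L (g (pt p)) = {q}"
      using L_in_fam[OF g\<Omega>[OF pt_in[OF p]]] by (auto simp: fam_def)
    then show ?thesis using p by (simp add: s_def)
  qed
  have inj_s: "inj_on s pts"
  proof (rule inj_onI)
    fix p q assume pq: "p \<in> pts" "q \<in> pts" "s p = s q"
    then have "g (pt p) = g (pt q)" using s L_eq_iff g\<Omega> pt_in by metis
    then have "pt p = pt q" using inj_g by (simp add: inj_eq)
    then show "p = q" using L_pt pq by (metis singleton_inject)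
  qed
  then have s_pts: "s ` pts = pts"
    using s finite_pts by (intro endo_inj_surj) auto
  then have perm: "s permutes pts"
    using inj_s by (intro bij_imp_permutes) (auto simp: bij_betw_def s_def)
  have s_eq: "s p = s q \<longleftrightarrow> p = q" for p q
    using permutes_inj[OF perm] by (simp add: inj_eq)
  \<comment> \<open>Lift the transposition of \<open>p\<close> and \<open>q\<close> to
    \<open>k\<close> in \<open>K\<close>. Its conjugate by \<open>g\<close> lies in \<open>K\<close>
    and swaps \<open>s p\<close> and \<open>s q\<close>, so these share a column. As
    \<open>k\<close> fixes \<open>u\<close> exactly if the conjugate fixes \<open>g u\<close>,
    \<open>L u\<close> separates \<open>p\<close> from \<open>q\<close> exactly if
    \<open>L (g u)\<close> separates \<open>s p\<close> from \<open>s q\<close>.\<close>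
  have transposition: "fst (s p) = fst (s q) \<and>
      (\<forall>u\<in>\<Omega>. (p \<in> L u \<longleftrightarrow> q \<in> L u) \<longleftrightarrow> (s p \<in> L (g u) \<longleftrightarrow> s q \<in> L (g u)))"
    if pq: "p \<in> pts" "q \<in> pts" "fst p = fst q" for p q
  proof -
    have tr: "transpose p q \<in> shift \<one>" using transpose_shift_one pq .
    then obtain k where k: "k \<in> carrier G" "acts (transpose p q) k"
      using ex_acts by blast
    then have "k \<in> K" using tr by (auto simp: K_def)
    then have "g \<otimes>\<^bsub>G\<^esub> k \<otimes>\<^bsub>G\<^esub> inv\<^bsub>G\<^esub> g \<in> K"
      using conj_mem_if_normalizer[OF g K_subset] by blast
    then obtain s' where s': "s' \<in> shift \<one>" "acts s' (g \<circ> k \<circ> inv\<^bsub>G\<^esub> g)"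
      by (auto simp: K_def mult_G)
    have act: "L (g (k u)) = s' ` L (g u)" if "u \<in> \<Omega>" for u
    proof -
      have "L ((g \<circ> k \<circ> inv\<^bsub>G\<^esub> g) (g u)) = s' ` L (g u)"
        using s'(2) g\<Omega>[OF that] unfolding acts_def by blast
      then show ?thesis using gG by (simp add: inv_apply)
    qed
    have conj: "s' (s r) = transpose (s p) (s q) (s r)" if r: "r \<in> pts" for r
    proof -
      let ?r = "transpose p q r"
      have r': "?r \<in> pts" using r pq by (simp add: transpose_def)
      have "L (k (pt r)) = {?r}" "k (pt r) \<in> \<Omega>"
        using k(2) r acts_pt pt_in by (auto simp: acts_def)
      then have "k (pt r) = pt ?r" using r' L_eq_iff L_pt pt_in by metis
      then have "s' ` {s r} = {s ?r}"
        using act[OF pt_in[OF r]] s[OF r] s[OF r'] by simp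
      then show ?thesis by (auto simp: transpose_def s_eq)
    qed
    have "s' (s p) = s q" using conj[OF pq(1)] by simp
    then have "fst (s q) = \<one> \<otimes> fst (s p)"
      using s'(1) s[OF pq(1)] by (auto simp: shift_def)
    then have "fst (s p) = fst (s q)"
      using s[OF pq(1)] by (simp add: mem_pts_iff)
    moreover have "(p \<in> L u \<longleftrightarrow> q \<in> L u) \<longleftrightarrow> (s p \<in> L (g u) \<longleftrightarrow> s q \<in> L (g u))" if u: "u \<in> \<Omega>" for u
    proof -
      have ku: "k u \<in> \<Omega>" "L (k u) = transpose p q ` L u"
        using k(2) u by (auto simp: acts_def)
      have "L (g u) \<subseteq> s ` pts"
        using fam_subset_pts[OF L_in_fam[OF g\<Omega>[OF u]]] s_pts by simp
      then have "s' ` L (g u) = transpose (s p) (s q) ` L (g u)"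
        using conj by (intro image_cong) auto
      then have "L (g (k u)) = transpose (s p) (s q) ` L (g u)"
        using act[OF u] by simp
      then have "transpose (s p) (s q) ` L (g u) = L (g u) \<longleftrightarrow> g (k u) = g u"
        using L_eq_iff g\<Omega> ku(1) u by metis
      also have "\<dots> \<longleftrightarrow> k u = u" using inj_g by (simp add: inj_eq)
      also have "\<dots> \<longleftrightarrow> transpose p q ` L u = L u"
        using ku L_eq_iff u by metis
      finally show ?thesis by (simp add: transpose_image_eq_iff)
    qed
    ultimately show ?thesis by blast
  qed
  \<comment> \<open>Row 0 can represent its column, since \<open>s\<close> keeps points of one
    column together.\<close>
  define \<sigma> where "\<sigma> e = fst (s (e, 0))" for e
  have z: "(e, 0) \<in> pts" if "e \<in> carrier T" for e
    using that five_le_m by (simp add: mem_pts_iff)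
  have fst_s: "fst (s p) = \<sigma> (fst p)" if "p \<in> pts" for p
    using transposition[OF that, of "(fst p, 0)"] that z
    by (auto simp: \<sigma>_def mem_pts_iff)
  have \<sigma>_in: "\<sigma> e \<in> carrier T" if "e \<in> carrier T" for e
    using s[OF z[OF that]] by (simp add: \<sigma>_def mem_pts_iff)
  have s_col: "s ` col e = col (\<sigma> e)" if e: "e \<in> carrier T" for e
  proof (rule card_subset_eq[OF finite_col])
    show "s ` col e \<subseteq> col (\<sigma> e)"
    proof
      fix q assume "q \<in> s ` col e"
      then obtain p where p: "p \<in> col e" "q = s p" by blast
      then have "p \<in> pts" using col_subset e by blast
      then have "s p \<in> pts" "fst (s p) = \<sigma> e" using s fst_s p by (auto simp: mem_col_iff)
      then show "q \<in> col (\<sigma> e)" using p by (simp add: mem_col_iff mem_pts_iff)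
    qed
    show "card (s ` col e) = card (col (\<sigma> e))"
      using permutes_inj_on[OF perm] by (simp add: card_image card_col)
  qed
  have L_g: "L (g u) = s ` L u" if u: "u \<in> \<Omega>" for u
  proof -
    \<comment> \<open>\<open>L u\<close> and the preimage of \<open>L (g u)\<close> under
      \<open>s\<close> each fill less than half of the column of \<open>q\<close>, so some
      \<open>p\<close> there avoids both. Comparing \<open>q\<close> with this \<open>p\<close>
      decides membership.\<close>
    have mem: "q \<in> L u \<longleftrightarrow> s q \<in> L (g u)" if q: "q \<in> pts" for q
    proof -
      let ?e = "fst q"
      let ?A = "col ?e \<inter> L u" and ?B = "col ?e \<inter> {r. s r \<in> L (g u)}"
      have e: "?e \<in> carrier T" using q by (simp add: mem_pts_iff)
      have "s ` ?B \<subseteq> col (\<sigma> ?e) \<inter> L (g u)" using s_col[OF e] by blast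
      then have "card ?B \<le> card (col (\<sigma> ?e) \<inter> L (g u))"
        using permutes_inj_on[OF perm] finite_col by (intro card_inj_on_le) auto
      then have "2 * card ?A < m" "2 * card ?B < m"
        using card_col_Int_less[OF L_in_fam[OF u] e]
          card_col_Int_less[OF L_in_fam[OF g\<Omega>[OF u]] \<sigma>_in[OF e]] by auto
      then have "card (?A \<union> ?B) < card (col ?e)"
        using card_Un_le[of ?A ?B] by (simp add: card_col)
      then have "\<not> col ?e \<subseteq> ?A \<union> ?B"
        using card_mono[of "?A \<union> ?B" "col ?e"] finite_col by auto
      then obtain p where p: "p \<in> col ?e" "p \<notin> L u" "s p \<notin> L (g u)" by blast
      then have "p \<in> pts" "fst p = fst q" using e by (auto simp: mem_col_iff mem_pts_iff)
      then show ?thesis using transposition[OF _ q] u p by blast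
    qed
    have "L u \<subseteq> pts" "L (g u) \<subseteq> s ` pts"
      using fam_subset_pts L_in_fam u g\<Omega> s_pts by auto
    then show ?thesis using mem by blast
  qed
  then have acts: "acts s g" using g\<Omega> by (simp add: acts_def)
  \<comment> \<open>A test set with profile \<open>j\<close> itself: the profile of its image
    reveals \<open>\<sigma>\<close>.\<close>
  obtain A where A: "A \<in> profiled" "\<And>e. e \<in> carrier T \<Longrightarrow> card (col e \<inter> A) = j e"
    using ex_profile by blast
  define u where "u = inv_into \<Omega> L A"
  have u: "u \<in> \<Omega>" "L u = A"
    using L_inv_into[of A] A(1) by (auto simp: u_def fam_def)
  have card_sA: "card (col (\<sigma> e) \<inter> s ` A) = j e" if e: "e \<in> carrier T" for e
  proof -
    have "col (\<sigma> e) \<inter> s ` A = s ` (col e \<inter> A)"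
      using s_col[OF e] permutes_inj[OF perm] by (simp add: image_Int)
    then show ?thesis
      using A(2)[OF e] permutes_inj_on[OF perm] by (simp add: card_image)
  qed
  have "s ` A \<in> fam" using L_in_fam[OF g\<Omega>[OF u(1)]] L_g u by simp
  moreover have "s ` A \<noteq> {p}" for p
  proof
    assume "s ` A = {p}"
    then have "card (col (\<sigma> \<one>) \<inter> s ` A) \<le> 1"
      using card_mono[of "{p}" "col (\<sigma> \<one>) \<inter> s ` A"] by simp
    then show False using card_sA[of \<one>] j_bounds[of \<one>] by simp
  qed
  ultimately obtain x where x: "x \<in> carrier T"
    "\<And>e. e \<in> carrier T \<Longrightarrow> card (col e \<inter> s ` A) = j (x \<otimes> e)"
    by (auto simp: fam_def profiled_def)
  \<comment> \<open>Counting column \<open>\<sigma> e\<close> of the image in two ways and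
    cancelling \<open>j\<close> shows that \<open>\<sigma>\<close> is a left translation.\<close>
  have "\<sigma> e = inv x \<otimes> e" if e: "e \<in> carrier T" for e
  proof -
    have "j (x \<otimes> \<sigma> e) = j e" using x(2)[OF \<sigma>_in[OF e]] card_sA[OF e] by simp
    then have "x \<otimes> \<sigma> e = e"
      using inj_j x(1) e \<sigma>_in[OF e] by (auto dest: inj_onD)
    then show ?thesis using x(1) e \<sigma>_in[OF e] by (metis inv_solve_left)
  qed
  then have "s \<in> shift (inv x)"
    using perm fst_s by (auto simp: shift_def mem_pts_iff)
  then show "g \<in> N" using gG acts x(1) by (auto simp: N_def intro!: bexI[of _ "inv x"])
qed

lemma normalizer_quotient_action: "normalizer_quotient T G"
  using normalizer_quotientI[OF G.group_axioms group_axioms subgroup_N \<theta>_hom \<theta>_onto K_eq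
      normalizer_subset] .

end

section \<open>Symmetric and alternating groups of large degree\<close>

theorem corollary1p2:
  fixes T :: "('a, 'b) monoid_scheme"
  assumes "group T" and "finite (carrier T)"
  shows "\<exists>n\<^sub>0::nat. \<forall>n\<ge>n\<^sub>0.
    normalizer_quotient T (sym_group n) \<and> normalizer_quotient T (alt_group n)"
proof -
  obtain f :: "'a \<Rightarrow> nat" where f: "inj_on f (carrier T)"
    using assms(2) finite_imp_inj_to_nat_seg by blast
  \<comment> \<open>Adding 2 gives the lower bound on \<open>j\<close>; \<open>m\<close> is just
    above twice its maximum.\<close>
  define j where "j e = f e + 2" for e
  define m where "m = 2 * Max (j ` carrier T) + 1"
  interpret column_code T j m
  proof (intro column_code.intro column_code_axioms.intro assms)
    show "inj_on j (carrier T)" using f by (auto simp: j_def inj_on_def)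
    fix e assume "e \<in> carrier T"
    then have "j e \<le> Max (j ` carrier T)" using assms(2) by simp
    then show "2 \<le> j e \<and> 2 * j e < m" by (simp add: m_def j_def)
  qed
  define b where "b = card fam"
  obtain L where L: "bij_betw L {1..b} fam"
    using ex_bij_betw_nat_finite_1[OF finite_fam] by (auto simp: b_def)
  show ?thesis
  \<comment> \<open>This leaves at least \<open>b + 3\<close> points for \<open>\<Delta>\<close>,
    the interval above \<open>b\<close>.\<close>
  proof (intro exI[of _ "2 * b + 3"] allI impI)
    fix n assume n: "2 * b + 3 \<le> n"
    have U: "{1..b} \<union> {b<..n} = {1..n}" using n by auto
    have nb: "b < n - b" "3 \<le> n - b" using n by linarith+
    have "column_action T j m (sym_group n) {1..b} {b<..n} L"
      unfolding column_action_def column_action_axioms_def U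
      using column_code_axioms sym_group_is_group L nb
      by (simp add: sym_group_carrier sym_group_mult sym_group_one disjoint_iff)
    \<comment> \<open>An odd \<open>g\<close> becomes even after composition with one
      transposition.\<close>
    moreover have "g \<in> carrier (alt_group n) \<or> g \<circ> transpose c d \<in> carrier (alt_group n)"
      if "g permutes {1..n}" "c \<in> {b<..n}" "d \<in> {b<..n}" "c \<noteq> d" for g c d
    proof -
      have "transpose c d permutes {1..n}"
        using that by (intro permutes_swap_id) auto
      then have "g \<circ> transpose c d permutes {1..n}"
        using that(1) by (rule permutes_compose)
      moreover have "permutation g" using that(1) by (auto simp: permutation_permutes)
      ultimately show ?thesis
        using that by (auto simp: alt_group_carrier evenperm_comp permutation_swap_id evenperm_swap)
    qed
    then have "column_action T j m (alt_group n) {1..b} {b<..n} L"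
      unfolding column_action_def column_action_axioms_def U
      using column_code_axioms alt_group_is_group L nb
      by (simp add: alt_group_carrier alt_group_mult alt_group_one disjoint_iff)
    ultimately show "normalizer_quotient T (sym_group n) \<and> normalizer_quotient T (alt_group n)"
      using column_action.normalizer_quotient_action by blast
  qed
qed

end
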